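(* Let $G$ be a connected graph with two or more vertices and let $U\subseteq V(G)$. (a) If $U=\emptyset$, then $(-1)^{|E(G)|+|V(G)|}\,\tilde\chi(\Delta^G_U)\le 0$. (b) If $|U|=1$, then $(-1)^{|E(G)|+|V(G)|}\,\tilde\chi(\Delta^G_U)=0$. (c) If $|U|\ge 1$, then $(-1)^{|E(G)|+|V(G)|}\,\tilde\chi(\Delta^G_U)\ge 0$.
   Context: Graphs are finite and undirected; loops and parallel edges are allowed. A nucleus of $G$ is a (nonempty) connected subgraph $N\subseteq G$ such that $V(N)$ is a vertex cover of $G$ (every edge of $G$, including loops, has at least one endpoint in $V(N)$); a single vertex with no edges is allowed as a connected subgraph. $\mathcal{N}(G)$ is the set of nuclei. For a connected graph $G$ and $U\subseteq V(G)$, the $U$-nucleus complex is the simplicial complex on vertex set $E(G)$ $$\Delta^G_U=\{E(G)\setminus E(N): N\in\mathcal{N}(G),\ V(N)\supseteq U\}.$$ One exception: if $G=cK_2$ is the graph with two vertices joined by $c\ge1$ parallel edges and no loops, and $U=\emptyset$, then $\Delta^{cK_2}_\emptyset$ is the $\Delta$-complex consisting of two $(c-1)$-dimensional simplices on vertex set $E(cK_2)$ glued along their boundaries (one top simplex for each of the two single-vertex nuclei, counted separately). The reduced Euler characteristic is $\tilde\chi(\Delta)=\sum_{\sigma}(-1)^{\dim\sigma}$, the sum over all faces $\sigma$ including the empty face, with $\dim\sigma=|\sigma|-1$. *)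

theory Defs
  imports Main
begin

text \<open>Finite undirected graphs with loops and parallel edges. An edge is mapped to the set of
  its endpoints, which is a singleton exactly when the edge is a loop.\<close>

record ('v, 'e) multigraph =
  verts :: "'v set"
  edges :: "'e set"
  ends :: "'e \<Rightarrow> 'v set"

definition fin_multigraph :: "('v, 'e) multigraph \<Rightarrow> bool" where
  "fin_multigraph G \<longleftrightarrow> finite (verts G) \<and> finite (edges G) \<and>
     (\<forall>e\<in>edges G. ends G e \<subseteq> verts G \<and> card (ends G e) \<in> {1, 2})"

definition adjacency :: "('v, 'e) multigraph \<Rightarrow> ('v \<times> 'v) set" where
  "adjacency G = {(x, y). \<exists>e\<in>edges G. ends G e = {x, y}}"

definition graph_connected :: "('v, 'e) multigraph \<Rightarrow> bool" where
  "graph_connected G \<longleftrightarrow> verts G \<noteq> {} \<and> (\<forall>x\<in>verts G. \<forall>y\<in>verts G. (x, y) \<in> (adjacency G)\<^sup>*)"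

text \<open>Subgraphs carry the whole map \<open>ends\<close> of the ambient graph, so that a subgraph is
  determined by its vertices and edges.\<close>

definition subgraph_of :: "('v, 'e) multigraph \<Rightarrow> ('v, 'e) multigraph \<Rightarrow> bool" where
  "subgraph_of N G \<longleftrightarrow> fin_multigraph N \<and> verts N \<subseteq> verts G \<and> edges N \<subseteq> edges G \<and> ends N = ends G"

definition vertex_cover :: "('v, 'e) multigraph \<Rightarrow> 'v set \<Rightarrow> bool" where
  "vertex_cover G W \<longleftrightarrow> W \<subseteq> verts G \<and> (\<forall>e\<in>edges G. ends G e \<inter> W \<noteq> {})"

definition nuclei :: "('v, 'e) multigraph \<Rightarrow> ('v, 'e) multigraph set" where
  "nuclei G = {N. subgraph_of N G \<and> graph_connected N \<and> vertex_cover G (verts N)}"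

definition nucleus_faces :: "('v, 'e) multigraph \<Rightarrow> 'v set \<Rightarrow> 'e set set" where
  "nucleus_faces G U = {edges G - edges N | N. N \<in> nuclei G \<and> U \<subseteq> verts N}"

text \<open>The graph \<open>cK\<^sub>2\<close> for some \<open>c \<ge> 1\<close>: two vertices joined by \<open>c\<close> parallel edges, no loops.\<close>

definition is_cK2 :: "('v, 'e) multigraph \<Rightarrow> bool" where
  "is_cK2 G \<longleftrightarrow> fin_multigraph G \<and> card (verts G) = 2 \<and> edges G \<noteq> {} \<and>
     (\<forall>e\<in>edges G. ends G e = verts G)"

text \<open>The \<open>U\<close>-nucleus complex, given by its simplices (the empty one included). A simplex is a
  pair of its vertex set and a label; the label distinguishes simplices with the same vertex set,
  and the proper faces of a simplex are the simplices on the proper subsets of its vertex set.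
  The label is \<^term>\<open>None\<close> except for \<open>cK\<^sub>2\<close> with \<open>U = {}\<close>. There the complex consists of two
  simplices on the full edge set glued along their boundaries, and each of the two is labelled by
  the vertex of the corresponding single-vertex nucleus.\<close>

definition nucleus_complex :: "('v, 'e) multigraph \<Rightarrow> 'v set \<Rightarrow> ('e set \<times> 'v option) set" where
  "nucleus_complex G U =
     (if is_cK2 G \<and> U = {}
      then {\<sigma>. \<sigma> \<subset> edges G} \<times> {None} \<union> {edges G} \<times> Some ` verts G
      else nucleus_faces G U \<times> {None})"

text \<open>The exponent \<open>card \<sigma> + 1\<close> has the parity of \<open>dim \<sigma> = card \<sigma> - 1\<close>, also for the empty
  simplex, of dimension \<open>-1\<close>.\<close>

definition reduced_euler_char :: "('e set \<times> 'l) set \<Rightarrow> int" where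
  "reduced_euler_char K = (\<Sum>(\<sigma>, l)\<in>K. (- 1) ^ (card \<sigma> + 1))"

end

theory Submission
  imports Defs
begin

text \<open>
  Up to the sign \<open>(-1)\<^bsup>|E|\<^esup>\<close> and a global minus, the reduced Euler characteristic of the
  nucleus complex is the sum of \<open>(-1)\<^bsup>|E(N)|\<^esup>\<close> over the nuclei \<open>N\<close> with \<open>U \<subseteq> V(N)\<close>, because
  a nucleus is determined by its edges
  (\<open>nucleus_verts_determined_by_edges\<close>), except for \<open>cK\<^sub>2\<close> with \<open>U = {}\<close>,
  where the complex is evaluated directly. So the claim concerns the sign of
  \<open>f(G, U) = (-1)\<^bsup>|V(G)|\<^esup> \<Sum>\<^sub>N (-1)\<^bsup>|E(N)|\<^esup>\<close>, which is \<open>nucleus_sum\<close>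
  below: it has to be nonnegative for \<open>U = {}\<close>, nonpositive for \<open>U \<noteq> {}\<close>, and zero for \<open>|U| = 1\<close>.

  The factor \<open>(-1)\<^bsup>|V(G)|\<^esup>\<close> makes the deletion-contraction rule for a non-loop edge \<open>e\<close> free of
  signs: \<open>f(G, U) = f(G \<setminus> e, U) + f(G / e, U / e)\<close>
  (\<open>nucleus_sum_deletion_contraction\<close>). Contraction preserves connectedness as well as
  emptiness of \<open>U\<close> and the property \<open>|U| = 1\<close>, so an induction on the number of edges only has to
  deal with the following exceptional situations.
  \<^item> A graph with a loop has \<open>f = 0\<close>: every nucleus contains the vertex of the loop, so adding or
    removing the loop is a sign-reversing involution.
  \<^item> Contraction must not lead to a single vertex, where the signs are wrong. So the induction
    starts with the loopless graphs on two vertices, where \<open>f\<close> is computed.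
  \<^item> Deletion may disconnect \<open>G\<close>. A nucleus of \<open>G \<setminus> e\<close> lies in one part and covers all edges of the
    other part, which is then a single vertex, a leaf of \<open>G\<close> outside \<open>U\<close>
    (\<open>disconnecting_edge_with_nucleus_is_leaf\<close>). If \<open>G\<close> has such a leaf and at least three
    vertices, then \<open>f = 0\<close> by the involution that adds or removes the leaf together with its edge.
    If it has none, the deletion term of a disconnecting edge vanishes.
\<close>

section \<open>Connectedness by cuts\<close>

definition closed_under :: "('e \<Rightarrow> 'v set) \<Rightarrow> 'e set \<Rightarrow> 'v set \<Rightarrow> bool" where
  "closed_under f S A \<longleftrightarrow> (\<forall>s\<in>S. f s \<inter> A \<noteq> {} \<longrightarrow> f s \<subseteq> A)"

text \<open>Connectedness is defined by cuts because closed sets have explicit images and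
  preimages when a leaf is attached or an edge is contracted; with paths, each of these operations
  would need an induction.\<close>

definition cut_connected :: "('e \<Rightarrow> 'v set) \<Rightarrow> 'v set \<Rightarrow> 'e set \<Rightarrow> bool" where
  "cut_connected f W S \<longleftrightarrow> W \<noteq> {} \<and> (\<forall>s\<in>S. f s \<subseteq> W) \<and>
     (\<forall>A. A \<subseteq> W \<longrightarrow> A \<noteq> {} \<longrightarrow> closed_under f S A \<longrightarrow> A = W)"

lemma cut_connectedD:
  "cut_connected f W S \<Longrightarrow> A \<subseteq> W \<Longrightarrow> A \<noteq> {} \<Longrightarrow> closed_under f S A \<Longrightarrow> A = W"
  by (auto simp: cut_connected_def)

lemma graph_connected_iff_cut_connected:
  assumes fin: "fin_multigraph N"
  shows "graph_connected N \<longleftrightarrow> cut_connected (ends N) (verts N) (edges N)"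
proof
  assume con: "graph_connected N"
  have "A = verts N"
    if A: "A \<subseteq> verts N" "A \<noteq> {}" and cl: "closed_under (ends N) (edges N) A" for A
  proof -
    obtain a where a: "a \<in> A" using A by auto
    have "b \<in> A" if "(a, b) \<in> (adjacency N)\<^sup>*" for b
      using that
    proof induction
      case base
      show ?case by (rule a)
    next
      case (step y z)
      then show ?case using cl by (fastforce simp: adjacency_def closed_under_def)
    qed
    then show ?thesis using con A a by (auto simp: graph_connected_def)
  qed
  then show "cut_connected (ends N) (verts N) (edges N)"
    using fin con by (auto simp: cut_connected_def fin_multigraph_def graph_connected_def)
next
  assume cc: "cut_connected (ends N) (verts N) (edges N)"
  have "(x, y) \<in> (adjacency N)\<^sup>*" if x: "x \<in> verts N" and y: "y \<in> verts N" for x y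
  proof -
    let ?A = "{z \<in> verts N. (x, z) \<in> (adjacency N)\<^sup>*}"
    have "closed_under (ends N) (edges N) ?A"
      unfolding closed_under_def
    proof (intro ballI impI subsetI)
      fix s w
      assume s: "s \<in> edges N" and m: "ends N s \<inter> ?A \<noteq> {}" and w: "w \<in> ends N s"
      obtain z where z: "z \<in> ends N s" "(x, z) \<in> (adjacency N)\<^sup>*" using m by auto
      have sub: "ends N s \<subseteq> verts N" and "card (ends N s) = 1 \<or> card (ends N s) = 2"
        using fin s by (auto simp: fin_multigraph_def)
      then have "w = z \<or> ends N s = {z, w}"
        using z(1) w by (auto simp: card_1_singleton_iff card_2_iff)
      then have "w = z \<or> (z, w) \<in> adjacency N" using s by (auto simp: adjacency_def)
      then show "w \<in> ?A" using z w sub by (auto intro: rtrancl_into_rtrancl)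
    qed
    then have "?A = verts N" using x by (intro cut_connectedD[OF cc]) auto
    then show ?thesis using y by auto
  qed
  then show "graph_connected N" using cc by (auto simp: graph_connected_def cut_connected_def)
qed

lemma cut_connected_no_edges: "cut_connected f W {} \<Longrightarrow> \<exists>w. W = {w}"
  unfolding cut_connected_def closed_under_def by blast

lemma cut_connected_verts_eq_ends:
  assumes "cut_connected f W S" "S \<noteq> {}" "\<forall>s\<in>S. f s \<noteq> {}"
  shows "W = \<Union> (f ` S)"
proof -
  have "closed_under f S (\<Union> (f ` S))" by (auto simp: closed_under_def)
  moreover have "\<Union> (f ` S) \<noteq> {}" using assms(2,3) by auto
  moreover have "\<Union> (f ` S) \<subseteq> W" using assms(1) by (auto simp: cut_connected_def)
  ultimately show ?thesis using cut_connectedD[OF assms(1)] by metis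
qed

section \<open>The signed count of nuclei\<close>

text \<open>The graphs \<open>G\<close>, \<open>G \<setminus> e\<close> and \<open>G / e\<close> are compared through their nuclei. A pair of vertices and
  edges leaves out the map \<^const>\<open>ends\<close>, so that a nucleus of \<open>G / e\<close> that avoids the
  contracted edge is equal to a nucleus of \<open>G \<setminus> e\<close>.\<close>

definition nucleus_pairs :: "('v, 'e) multigraph \<Rightarrow> 'v set \<Rightarrow> ('v set \<times> 'e set) set" where
  "nucleus_pairs G U = {(W, S). W \<subseteq> verts G \<and> S \<subseteq> edges G \<and> cut_connected (ends G) W S \<and>
     U \<subseteq> W \<and> (\<forall>s\<in>edges G. ends G s \<inter> W \<noteq> {})}"

definition nucleus_sum :: "('v, 'e) multigraph \<Rightarrow> 'v set \<Rightarrow> int" where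
  "nucleus_sum G U = (-1) ^ card (verts G) * (\<Sum>(W, S)\<in>nucleus_pairs G U. (-1) ^ card S)"

lemma finite_nucleus_pairs: "fin_multigraph G \<Longrightarrow> finite (nucleus_pairs G U)"
  by (rule finite_subset[of _ "Pow (verts G) \<times> Pow (edges G)"])
     (auto simp: nucleus_pairs_def fin_multigraph_def)

lemma nucleus_pairs_conv_nuclei:
  assumes "fin_multigraph G"
  shows "nucleus_pairs G U = (\<lambda>N. (verts N, edges N)) ` {N \<in> nuclei G. U \<subseteq> verts N}"
proof (intro set_eqI iffI; clarify)
  fix W S assume n: "(W, S) \<in> nucleus_pairs G U"
  define N where "N = \<lparr>verts = W, edges = S, ends = ends G\<rparr>"
  have fin: "fin_multigraph N"
    using n assms by (auto simp: N_def nucleus_pairs_def fin_multigraph_def cut_connected_def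
        intro: finite_subset)
  have "N \<in> nuclei G"
    using n fin graph_connected_iff_cut_connected[OF fin]
    by (auto simp: nuclei_def subgraph_of_def vertex_cover_def nucleus_pairs_def N_def)
  moreover have "verts N = W" "edges N = S" "U \<subseteq> W"
    using n by (auto simp: N_def nucleus_pairs_def)
  ultimately show "(W, S) \<in> (\<lambda>N. (verts N, edges N)) ` {N \<in> nuclei G. U \<subseteq> verts N}"
    by (auto simp: image_iff intro!: exI[of _ N])
next
  fix N assume "N \<in> nuclei G" "U \<subseteq> verts N"
  then show "(verts N, edges N) \<in> nucleus_pairs G U"
    using graph_connected_iff_cut_connected[of N]
    by (auto simp: nuclei_def subgraph_of_def vertex_cover_def nucleus_pairs_def)
qed

section \<open>Sign-reversing involutions\<close>

lemma sum_involution_zero: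
  fixes g :: "'a \<Rightarrow> int"
  assumes "\<And>a. a \<in> A \<Longrightarrow> t a \<in> A" "\<And>a. a \<in> A \<Longrightarrow> t (t a) = a"
    and "\<And>a. a \<in> A \<Longrightarrow> g (t a) = - g a"
  shows "sum g A = 0"
proof -
  have "sum g A = (\<Sum>a\<in>A. - g a)"
    by (rule sum.reindex_bij_witness[of A t t]) (use assms in auto)
  then show ?thesis by (simp add: sum_negf)
qed

definition toggle :: "'e \<Rightarrow> 'e set \<Rightarrow> 'e set" where
  "toggle e S = (if e \<in> S then S - {e} else insert e S)"

lemma toggle_toggle [simp]: "toggle e (toggle e S) = S"
  by (auto simp: toggle_def)

lemma sign_toggle:
  assumes "finite S"
  shows "(-1 :: int) ^ card (toggle e S) = - ((-1) ^ card S)"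
proof (cases "e \<in> S")
  case True
  then obtain T where "S = insert e T" "e \<notin> T" by (meson mk_disjoint_insert)
  then show ?thesis using assms by (simp add: toggle_def)
next
  case False
  then show ?thesis using assms by (simp add: toggle_def)
qed

lemma sum_signs_Pow:
  assumes "finite E" "E \<noteq> {}"
  shows "(\<Sum>S\<in>Pow E. (-1 :: int) ^ card S) = 0"
proof -
  obtain e where "e \<in> E" using assms by auto
  then have "S \<in> Pow E \<Longrightarrow> toggle e S \<in> Pow E" for S by (auto simp: toggle_def)
  moreover have "S \<in> Pow E \<Longrightarrow> finite S" for S
    using assms(1) by (auto intro: finite_subset)
  ultimately show ?thesis
    by (intro sum_involution_zero[where t = "toggle e"]) (simp_all only: sign_toggle toggle_toggle)
qed

lemma nucleus_sum_zero_if_toggle: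
  assumes fin: "fin_multigraph G"
    and closed: "\<And>W S. (W, S) \<in> nucleus_pairs G U \<Longrightarrow> (h W, toggle e S) \<in> nucleus_pairs G U"
    and inv: "\<And>W. h (h W) = W"
  shows "nucleus_sum G U = 0"
proof -
  have sign: "(-1 :: int) ^ card (toggle e S) = - ((-1) ^ card S)"
    if "(W, S) \<in> nucleus_pairs G U" for W S
    using that fin by (intro sign_toggle)
      (auto simp: nucleus_pairs_def fin_multigraph_def intro: finite_subset)
  have "(\<Sum>(W, S)\<in>nucleus_pairs G U. (-1 :: int) ^ card S) = 0"
    by (rule sum_involution_zero[where t = "\<lambda>(W, S). (h W, toggle e S)"])
       (use closed inv sign in auto)
  then show ?thesis by (simp add: nucleus_sum_def)
qed

text \<open>A vertex cover contains the vertex of every loop, and loops do not affect connectedness.\<close>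

lemma nucleus_sum_loop:
  assumes fin: "fin_multigraph G" and e: "e \<in> edges G" "ends G e = {v}"
  shows "nucleus_sum G U = 0"
proof -
  have closed: "closed_under (ends G) (toggle e S) A = closed_under (ends G) S A" for S A
    using e by (auto simp: closed_under_def toggle_def)
  show ?thesis
  proof (rule nucleus_sum_zero_if_toggle[OF fin, where h = "\<lambda>W. W"])
    fix W S assume n: "(W, S) \<in> nucleus_pairs G U"
    then have "v \<in> W" using e by (auto simp: nucleus_pairs_def)
    then have "cut_connected (ends G) W (toggle e S)"
      using n e unfolding nucleus_pairs_def cut_connected_def closed
      by (auto simp: toggle_def)
    then show "(W, toggle e S) \<in> nucleus_pairs G U"
      using n e by (auto simp: nucleus_pairs_def toggle_def)
  qed simp
qed

definition leaf_at :: "('v, 'e) multigraph \<Rightarrow> 'e \<Rightarrow> 'v \<Rightarrow> 'v \<Rightarrow> bool" where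
  "leaf_at G e x y \<longleftrightarrow> e \<in> edges G \<and> ends G e = {x, y} \<and> x \<noteq> y \<and>
     (\<forall>s\<in>edges G. x \<in> ends G s \<longrightarrow> s = e)"

text \<open>A set that is closed under \<open>e\<close> contains both or none of \<open>x\<close>, \<open>y\<close>, so its trace on \<open>W\<close>
  determines it.\<close>

lemma cut_connected_attach_leaf:
  assumes e: "f e = {x, y}" "x \<noteq> y" and W: "x \<notin> W" "y \<in> W" and S: "e \<notin> S"
    and noS: "\<forall>s\<in>S. x \<notin> f s"
  shows "cut_connected f (insert x W) (insert e S) \<longleftrightarrow> cut_connected f W S"
proof
  assume c: "cut_connected f (insert x W) (insert e S)"
  have "A = W" if A: "A \<subseteq> W" "A \<noteq> {}" "closed_under f S A" for A
  proof -
    let ?B = "if y \<in> A then insert x A else A"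
    have "closed_under f (insert e S) ?B"
      using A e W noS by (auto simp: closed_under_def)
    then have "?B = insert x W" using A by (intro cut_connectedD[OF c]) auto
    then show ?thesis using A W by (auto split: if_splits)
  qed
  then show "cut_connected f W S"
    using c W noS unfolding cut_connected_def by blast
next
  assume c: "cut_connected f W S"
  have "A = insert x W"
    if A: "A \<subseteq> insert x W" "A \<noteq> {}" "closed_under f (insert e S) A" for A
  proof -
    have xy: "x \<in> A \<longleftrightarrow> y \<in> A" using A(3) e by (auto simp: closed_under_def)
    have "closed_under f S (A \<inter> W)"
      using A(3) c by (fastforce simp: closed_under_def cut_connected_def)
    moreover have "A \<inter> W \<noteq> {}" using A W xy by auto
    ultimately have "A \<inter> W = W" by (intro cut_connectedD[OF c]) auto
    then show ?thesis using A W xy by auto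
  qed
  then show "cut_connected f (insert x W) (insert e S)"
    using c W e by (auto simp: cut_connected_def)
qed

text \<open>A nucleus without the leaf \<open>x\<close> contains its neighbour \<open>y\<close>, because it covers \<open>e\<close>. A nucleus with
  the leaf contains \<open>e\<close> as well, unless it is the single vertex \<open>x\<close>; that is excluded because then
  \<open>e\<close> would be the only edge, so a connected graph would have just two vertices. Hence \<open>x\<close> and \<open>e\<close>
  can be added or removed simultaneously.\<close>

lemma nucleus_sum_leaf:
  assumes fin: "fin_multigraph G" and con: "cut_connected (ends G) (verts G) (edges G)"
    and leaf: "leaf_at G e x y" and card: "card (verts G) \<ge> 3" and U: "x \<notin> U"
  shows "nucleus_sum G U = 0"
proof -
  have e: "e \<in> edges G" "ends G e = {x, y}" "x \<noteq> y"
    and only: "\<And>s. s \<in> edges G \<Longrightarrow> x \<in> ends G s \<Longrightarrow> s = e"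
    using leaf by (auto simp: leaf_at_def)
  have xyV: "x \<in> verts G" "y \<in> verts G"
    using e fin by (auto simp: fin_multigraph_def)
  have incident: "x \<in> W \<longleftrightarrow> e \<in> S" "y \<in> W" if n: "(W, S) \<in> nucleus_pairs G U" for W S
  proof -
    have c: "cut_connected (ends G) W S" and sub: "S \<subseteq> edges G"
      and cover: "\<And>s. s \<in> edges G \<Longrightarrow> ends G s \<inter> W \<noteq> {}"
      using n by (auto simp: nucleus_pairs_def)
    have eS: "e \<in> S" if "x \<in> W"
    proof (rule ccontr)
      assume "e \<notin> S"
      then have "closed_under (ends G) S {x}"
        using sub only by (auto simp: closed_under_def)
      then have "{x} = W" using that by (intro cut_connectedD[OF c]) auto
      then have "edges G = {e}" using cover only e by blast
      then have "closed_under (ends G) (edges G) {x, y}" using e by (auto simp: closed_under_def)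
      then have "{x, y} = verts G" using xyV by (intro cut_connectedD[OF con]) auto
      moreover have "card {x, y} = 2" using e by simp
      ultimately show False using card by simp
    qed
    moreover have W: "x \<in> W \<and> y \<in> W" if "e \<in> S"
      using that c e by (auto simp: cut_connected_def)
    ultimately show "x \<in> W \<longleftrightarrow> e \<in> S" "y \<in> W" using cover[OF e(1)] e by auto
  qed
  show ?thesis
  proof (rule nucleus_sum_zero_if_toggle[OF fin, where h = "toggle x"])
    fix W S assume n: "(W, S) \<in> nucleus_pairs G U"
    note inc = incident[OF n]
    have props: "W \<subseteq> verts G" "S \<subseteq> edges G" "cut_connected (ends G) W S" "U \<subseteq> W"
      "\<And>s. s \<in> edges G \<Longrightarrow> ends G s \<inter> W \<noteq> {}"
      using n by (auto simp: nucleus_pairs_def)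
    have noS: "\<forall>s\<in>S - {e}. x \<notin> ends G s" using props(2) only by blast
    have "cut_connected (ends G) (toggle x W) (toggle e S)"
    proof (cases "x \<in> W")
      case True
      then have eS: "e \<in> S" using inc by simp
      have "cut_connected (ends G) (insert x (W - {x})) (insert e (S - {e})) \<longleftrightarrow>
          cut_connected (ends G) (W - {x}) (S - {e})"
        by (rule cut_connected_attach_leaf) (use e inc noS in auto)
      then show ?thesis using True eS props(3) by (simp add: toggle_def insert_absorb)
    next
      case False
      then have eS: "e \<notin> S" using inc by simp
      have "cut_connected (ends G) (insert x W) (insert e S) \<longleftrightarrow> cut_connected (ends G) W S"
        by (rule cut_connected_attach_leaf) (use False eS e inc noS in auto)
      then show ?thesis using False eS props(3) by (simp add: toggle_def)
    qed
    moreover have "ends G s \<inter> toggle x W \<noteq> {}" if "s \<in> edges G" for s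
    proof (cases "s = e")
      case True
      then show ?thesis using e inc by (auto simp: toggle_def)
    next
      case False
      then have "x \<notin> ends G s" using only that by blast
      then show ?thesis using props(5)[OF that] by (auto simp: toggle_def)
    qed
    moreover have "toggle x W \<subseteq> verts G" "toggle e S \<subseteq> edges G" "U \<subseteq> toggle x W"
      using props xyV e U by (auto simp: toggle_def)
    ultimately show "(toggle x W, toggle e S) \<in> nucleus_pairs G U"
      by (simp add: nucleus_pairs_def)
  qed simp
qed

section \<open>Deletion and contraction\<close>

definition delete_edge :: "'e \<Rightarrow> ('v, 'e) multigraph \<Rightarrow> ('v, 'e) multigraph" where
  "delete_edge e G = G\<lparr>edges := edges G - {e}\<rparr>"

text \<open>Contraction keeps the vertex type: \<open>x\<close> is merged into \<open>y\<close>.\<close>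

definition redirect :: "'v \<Rightarrow> 'v \<Rightarrow> 'v \<Rightarrow> 'v" where
  "redirect x y v = (if v = x then y else v)"

definition contract_edge :: "'e \<Rightarrow> 'v \<Rightarrow> 'v \<Rightarrow> ('v, 'e) multigraph \<Rightarrow> ('v, 'e) multigraph" where
  "contract_edge e x y G =
     \<lparr>verts = redirect x y ` verts G, edges = edges G - {e}, ends = (\<lambda>s. redirect x y ` ends G s)\<rparr>"

lemma delete_edge_simps [simp]:
  "verts (delete_edge e G) = verts G" "edges (delete_edge e G) = edges G - {e}"
  "ends (delete_edge e G) = ends G"
  by (simp_all add: delete_edge_def)

lemma contract_edge_simps [simp]:
  "verts (contract_edge e x y G) = redirect x y ` verts G"
  "edges (contract_edge e x y G) = edges G - {e}"
  "ends (contract_edge e x y G) = (\<lambda>s. redirect x y ` ends G s)"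
  by (simp_all add: contract_edge_def)

lemma fin_multigraph_delete_edge: "fin_multigraph G \<Longrightarrow> fin_multigraph (delete_edge e G)"
  by (auto simp: fin_multigraph_def)

lemma fin_multigraph_contract_edge:
  assumes "fin_multigraph G"
  shows "fin_multigraph (contract_edge e x y G)"
proof -
  have "card (redirect x y ` ends G s) \<in> {1, 2}" if "s \<in> edges G" for s
  proof -
    have "card (ends G s) = 1 \<or> card (ends G s) = 2"
      using assms that by (auto simp: fin_multigraph_def)
    then have fs: "finite (ends G s)" "ends G s \<noteq> {}" "card (ends G s) \<le> 2"
      by (auto simp: card_1_singleton_iff card_2_iff)
    have "card (redirect x y ` ends G s) \<le> 2" using card_image_le[OF fs(1)] fs(3) le_trans by blast
    moreover have "card (redirect x y ` ends G s) \<noteq> 0" using fs by simp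
    ultimately show ?thesis by auto
  qed
  then show ?thesis using assms by (auto simp: fin_multigraph_def)
qed

text \<open>Images and preimages under the merging of \<open>x\<close> with \<open>y\<close> match the sets closed under \<open>S\<close> after
  contraction with the sets closed under \<open>insert e S\<close>, since the latter do not separate \<open>x\<close> from
  \<open>y\<close>.\<close>

lemma cut_connected_contract:
  assumes e: "f e = {x, y}" and W: "x \<in> W" "y \<in> W" and S: "\<forall>s\<in>S. f s \<subseteq> W"
  shows "cut_connected (\<lambda>s. redirect x y ` f s) (redirect x y ` W) S \<longleftrightarrow>
         cut_connected f W (insert e S)" (is "cut_connected ?f ?W S \<longleftrightarrow> _")
proof
  assume c: "cut_connected ?f ?W S"
  have "A = W" if A: "A \<subseteq> W" "A \<noteq> {}" "closed_under f (insert e S) A" for A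
  proof -
    have xy: "x \<in> A \<longleftrightarrow> y \<in> A" using A(3) e by (auto simp: closed_under_def)
    then have img: "redirect x y v \<in> redirect x y ` A \<longleftrightarrow> v \<in> A" for v
      by (auto simp: redirect_def image_iff)
    have "closed_under ?f S (redirect x y ` A)"
      unfolding closed_under_def
    proof (intro ballI impI)
      fix s assume s: "s \<in> S" and "?f s \<inter> redirect x y ` A \<noteq> {}"
      then have "f s \<inter> A \<noteq> {}" using img by auto
      then show "?f s \<subseteq> redirect x y ` A" using A(3) s by (auto simp: closed_under_def)
    qed
    then have "redirect x y ` A = ?W" using A by (intro cut_connectedD[OF c]) auto
    then show ?thesis using A img by blast
  qed
  then show "cut_connected f W (insert e S)"
    using W e S by (auto simp: cut_connected_def)
next
  assume c: "cut_connected f W (insert e S)"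
  have "A = ?W" if A: "A \<subseteq> ?W" "A \<noteq> {}" "closed_under ?f S A" for A
  proof -
    let ?B = "{w \<in> W. redirect x y w \<in> A}"
    have "closed_under f (insert e S) ?B"
      unfolding closed_under_def
    proof (intro ballI impI subsetI)
      fix s w assume s: "s \<in> insert e S" "f s \<inter> ?B \<noteq> {}" "w \<in> f s"
      show "w \<in> ?B"
      proof (cases "s \<in> S")
        case True
        then have "?f s \<inter> A \<noteq> {}" using s by auto
        then have "?f s \<subseteq> A" using A(3) True by (simp add: closed_under_def)
        then show ?thesis using S True s(3) by auto
      next
        case False
        then have "f s = {x, y}" using s(1) e by auto
        then show ?thesis using s W by (auto simp: redirect_def split: if_splits)
      qed
    qed
    moreover have "?B \<noteq> {}" using A by auto
    ultimately have "?B = W" by (intro cut_connectedD[OF c]) auto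
    then show ?thesis using A by auto
  qed
  moreover have "\<forall>s\<in>S. ?f s \<subseteq> ?W" using S by blast
  ultimately show "cut_connected ?f ?W S" using W by (auto simp: cut_connected_def)
qed


text \<open>Nuclei of \<open>G\<close> that contain \<open>e\<close> correspond to nuclei of \<open>G / e\<close> through the merged vertex, with
  one edge less. Nuclei of \<open>G\<close> that do not contain \<open>e\<close> are the nuclei of \<open>G \<setminus> e\<close> that cover \<open>e\<close>. The
  nuclei of \<open>G \<setminus> e\<close> that do not cover \<open>e\<close> are exactly the nuclei of \<open>G / e\<close> that avoid the merged
  vertex. These enter the two sums with opposite signs, since \<open>G / e\<close> has one vertex less than
  \<open>G \<setminus> e\<close>, and cancel.\<close>

lemma nucleus_sum_deletion_contraction:
  assumes fin: "fin_multigraph G" and U: "U \<subseteq> verts G"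
    and e: "e \<in> edges G" "ends G e = {x, y}" "x \<noteq> y"
  shows "nucleus_sum G U =
    nucleus_sum (delete_edge e G) U + nucleus_sum (contract_edge e x y G) (redirect x y ` U)"
proof -
  let ?V = "verts G" and ?r = "redirect x y" and ?G' = "contract_edge e x y G"
  let ?g = "\<lambda>(W :: 'a set, S :: 'b set). (-1 :: int) ^ card S"
  have xyV: "x \<in> ?V" "y \<in> ?V" using e fin by (auto simp: fin_multigraph_def)
  have rV: "?r ` ?V = ?V - {x}" using xyV e by (auto simp: redirect_def image_iff)
  define A where "A = {(W, S) \<in> nucleus_pairs G U. e \<in> S}"
  define B where "B = {(W, S) \<in> nucleus_pairs G U. e \<notin> S}"
  define C where "C = {(W, S) \<in> nucleus_pairs (delete_edge e G) U. x \<notin> W \<and> y \<notin> W}"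
  define D where "D = {(W, S) \<in> nucleus_pairs ?G' (?r ` U). y \<in> W}"
  note finpairs = finite_nucleus_pairs[OF fin, of U]
    finite_nucleus_pairs[OF fin_multigraph_delete_edge[OF fin], of e U]
    finite_nucleus_pairs[OF fin_multigraph_contract_edge[OF fin], of e x y "?r ` U"]
  have finABCD: "finite A" "finite B" "finite C" "finite D"
    unfolding A_def B_def C_def D_def
    by (rule finite_subset[OF _ finpairs(1)], force)
       (rule finite_subset[OF _ finpairs(1)], force,
        rule finite_subset[OF _ finpairs(2)], force,
        rule finite_subset[OF _ finpairs(3)], force)
  have split_G: "nucleus_pairs G U = A \<union> B" "A \<inter> B = {}"
    by (auto simp: A_def B_def)
  have split_delete: "nucleus_pairs (delete_edge e G) U = B \<union> C" "B \<inter> C = {}"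
    using e by (auto simp: B_def C_def nucleus_pairs_def)
  have C_contract: "(W, S) \<in> C \<longleftrightarrow> (W, S) \<in> nucleus_pairs ?G' (?r ` U) \<and> y \<notin> W" for W S
  proof (cases "x \<in> W \<or> y \<in> W")
    case True
    then show ?thesis using rV by (auto simp: C_def nucleus_pairs_def)
  next
    case False
    have img: "?r ` X \<inter> Y = X \<inter> Y" "?r ` X \<subseteq> Y \<longleftrightarrow> X \<subseteq> Y" if "Y \<subseteq> W" for X Y
      using that False by (auto simp: redirect_def)
    have closed: "closed_under (\<lambda>s. ?r ` ends G s) S Y \<longleftrightarrow> closed_under (ends G) S Y"
      if "Y \<subseteq> W" for Y
      using img[OF that] by (simp add: closed_under_def)
    have "cut_connected (\<lambda>s. ?r ` ends G s) W S \<longleftrightarrow> cut_connected (ends G) W S"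
      unfolding cut_connected_def using closed img(2)[OF order_refl] by (simp cong: imp_cong)
    then show ?thesis
      using False rV img[of W] by (auto simp: C_def nucleus_pairs_def)
  qed
  then have split_contract: "nucleus_pairs ?G' (?r ` U) = D \<union> C" "D \<inter> C = {}"
    by (auto simp: D_def)
  have "sum ?g A = (\<Sum>p\<in>D. - ?g p)"
  proof (rule sum.reindex_bij_witness[where i = "\<lambda>(W, S). (insert x W, insert e S)"
        and j = "\<lambda>(W, S). (?r ` W, S - {e})"])
    fix p assume "p \<in> A"
    then obtain W S where p: "p = (W, S)" and n: "(W, S) \<in> nucleus_pairs G U" and eS: "e \<in> S"
      by (auto simp: A_def)
    have cc: "cut_connected (ends G) W S" and sub: "W \<subseteq> ?V" "S \<subseteq> edges G" "U \<subseteq> W"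
      and cover: "\<And>s. s \<in> edges G \<Longrightarrow> ends G s \<inter> W \<noteq> {}"
      using n by (auto simp: nucleus_pairs_def)
    have endsW: "\<forall>s\<in>S. ends G s \<subseteq> W" using cc by (simp add: cut_connected_def)
    then have xyW: "x \<in> W" "y \<in> W" using eS e by auto
    then have rW: "?r ` W = W - {x}" using e by (auto simp: redirect_def image_iff)
    show "(case (case p of (W, S) \<Rightarrow> (?r ` W, S - {e})) of
        (W, S) \<Rightarrow> (insert x W, insert e S)) = p"
      using eS xyW rW by (auto simp: p)
    have "cut_connected (\<lambda>s. ?r ` ends G s) (?r ` W) (S - {e})"
      by (subst cut_connected_contract[of "ends G" e])
         (use e xyW endsW eS cc in \<open>auto simp: insert_absorb\<close>)
    moreover have "?r ` ends G s \<inter> ?r ` W \<noteq> {}" if "s \<in> edges G" for s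
      using cover[OF that] by auto
    moreover have "?r ` W \<subseteq> ?r ` ?V" "?r ` U \<subseteq> ?r ` W" using sub by auto
    ultimately show "(case p of (W, S) \<Rightarrow> (?r ` W, S - {e})) \<in> D"
      using sub xyW rW e by (auto simp: p D_def nucleus_pairs_def)
    have "finite S" using sub fin by (auto simp: fin_multigraph_def intro: finite_subset)
    then show "- ?g (case p of (W, S) \<Rightarrow> (?r ` W, S - {e})) = ?g p"
      using sign_toggle[of S e] eS by (simp add: p toggle_def)
  next
    fix p assume "p \<in> D"
    then obtain W S where p: "p = (W, S)" and n: "(W, S) \<in> nucleus_pairs ?G' (?r ` U)"
      and yW: "y \<in> W"
      by (auto simp: D_def)
    have cc: "cut_connected (\<lambda>s. ?r ` ends G s) W S" and sub: "W \<subseteq> ?V - {x}" "S \<subseteq> edges G - {e}"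
      "?r ` U \<subseteq> W" and cover: "\<And>s. s \<in> edges G - {e} \<Longrightarrow> ?r ` ends G s \<inter> W \<noteq> {}"
      using n rV by (auto simp: nucleus_pairs_def)
    have rW: "?r ` insert x W = W" using sub yW by (auto simp: redirect_def image_iff)
    have preimage: "v \<in> insert x W" if "?r v \<in> W" for v
      using that by (auto simp: redirect_def split: if_splits)
    show "(case (case p of (W, S) \<Rightarrow> (insert x W, insert e S)) of
        (W, S) \<Rightarrow> (?r ` W, S - {e})) = p"
      using rW sub by (auto simp: p)
    have "\<forall>s\<in>S. ends G s \<subseteq> insert x W"
      using cc preimage unfolding cut_connected_def by blast
    then have "cut_connected (ends G) (insert x W) (insert e S)"
      using cut_connected_contract[of "ends G" e x y "insert x W" S] e yW cc rW by simp
    moreover have "ends G s \<inter> insert x W \<noteq> {}" if "s \<in> edges G" for s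
      using cover[of s] that e preimage by (cases "s = e") auto
    moreover have "U \<subseteq> insert x W" using sub preimage by blast
    ultimately show "(case p of (W, S) \<Rightarrow> (insert x W, insert e S)) \<in> A"
      using sub xyV e by (auto simp: p A_def nucleus_pairs_def)
  qed
  then have AD: "sum ?g A = - sum ?g D" by (simp only: sum_negf)
  have "card ?V = Suc (card (?r ` ?V))"
    using card.remove[of ?V x] xyV fin rV by (simp add: fin_multigraph_def)
  then show ?thesis
    unfolding nucleus_sum_def delete_edge_simps contract_edge_simps
      split_G(1) split_delete(1) split_contract(1)
    using AD split_G(2) split_delete(2) split_contract(2) finABCD
    by (simp add: sum.union_disjoint algebra_simps)
qed

text \<open>The nucleus lies on one side of a cut of \<open>G \<setminus> e\<close>, and no edge of \<open>G \<setminus> e\<close> on the other side can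
  be covered. So every vertex on the other side is incident with \<open>e\<close> only.\<close>

lemma disconnecting_edge_with_nucleus_is_leaf:
  assumes fin: "fin_multigraph G" and con: "cut_connected (ends G) (verts G) (edges G)"
    and e: "e \<in> edges G" "ends G e = {x, y}" "x \<noteq> y"
    and disc: "\<not> cut_connected (ends G) (verts G) (edges G - {e})"
    and n: "(W, S) \<in> nucleus_pairs (delete_edge e G) U"
  shows "\<exists>z w. leaf_at G e z w \<and> z \<notin> U"
proof -
  let ?E = "edges G - {e}" and ?V = "verts G"
  have cc: "cut_connected (ends G) W S" and sub: "W \<subseteq> ?V" "S \<subseteq> ?E" "U \<subseteq> W"
    and cover: "\<And>s. s \<in> ?E \<Longrightarrow> ends G s \<inter> W \<noteq> {}"
    using n by (auto simp: nucleus_pairs_def)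
  obtain A where A: "A \<subseteq> ?V" "A \<noteq> {}" "A \<noteq> ?V" "closed_under (ends G) ?E A"
    using disc con by (auto simp: cut_connected_def)
  have "closed_under (ends G) ?E (?V - A)"
    using A fin unfolding closed_under_def fin_multigraph_def by blast
  moreover have "W \<inter> A = {} \<or> W \<inter> A = W"
  proof -
    have "closed_under (ends G) S (W \<inter> A)"
      using A(4) cc sub(2) unfolding closed_under_def cut_connected_def by blast
    then show ?thesis using cut_connectedD[OF cc, of "W \<inter> A"] by blast
  qed
  ultimately obtain B where B: "B \<subseteq> ?V" "B \<noteq> {}" "B \<noteq> ?V" "closed_under (ends G) ?E B"
    "W \<inter> B = {}"
    using A that[of A] that[of "?V - A"] by blast
  \<comment> \<open>\<open>B\<close> is the side of the cut that the nucleus misses.\<close>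
  obtain z where z: "z \<in> B" using B by auto
  have zV: "{z} \<noteq> ?V" using B(1,3) z by (metis empty_iff subset_singletonD)
  have only: "s = e" if "s \<in> edges G" "z \<in> ends G s" for s
  proof (rule ccontr)
    assume "s \<noteq> e"
    then have "ends G s \<subseteq> B" using that B(4) z by (auto simp: closed_under_def)
    then show False using cover[of s] that \<open>s \<noteq> e\<close> B(5) by blast
  qed
  have "\<not> closed_under (ends G) (edges G) {z}"
    using cut_connectedD[OF con, of "{z}"] B(1) zV z by auto
  then obtain s where s: "s \<in> edges G" "z \<in> ends G s" by (auto simp: closed_under_def)
  then have "z \<in> {x, y}" using only e by auto
  then obtain w where "ends G e = {z, w}" "z \<noteq> w" using e by auto
  then have "leaf_at G e z w" unfolding leaf_at_def using e(1) only by blast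
  then show ?thesis using z B(5) sub(3) by blast
qed

section \<open>The sign of the nucleus sum\<close>

text \<open>The nuclei are the two single vertices and the nonempty sets of edges. The latter contribute
  \<open>-1\<close>, as the signs of all subsets cancel.\<close>

lemma nucleus_sum_two_verts:
  assumes fin: "fin_multigraph G" and V: "verts G = {x, y}" "x \<noteq> y"
    and E: "edges G \<noteq> {}" "\<forall>e\<in>edges G. ends G e = {x, y}" and U: "U \<subseteq> {x, y}"
  shows "nucleus_sum G U = of_bool (U \<subseteq> {x}) + of_bool (U \<subseteq> {y}) - 1"
proof -
  let ?g = "\<lambda>(W :: 'a set, S :: 'b set). (-1 :: int) ^ card S"
  let ?X = "if U \<subseteq> {x} then {({x}, {})} else ({} :: ('a set \<times> 'b set) set)"
  let ?Y = "if U \<subseteq> {y} then {({y}, {})} else ({} :: ('a set \<times> 'b set) set)"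
  let ?Z = "Pair {x, y} ` (Pow (edges G) - {{}})"
  have finE: "finite (edges G)" using fin by (simp add: fin_multigraph_def)
  have full: "cut_connected (ends G) {x, y} S \<longleftrightarrow> S \<noteq> {}" if "S \<subseteq> edges G" for S
  proof
    show "cut_connected (ends G) {x, y} S \<Longrightarrow> S \<noteq> {}"
      using cut_connected_no_edges[of "ends G" "{x, y}"] V by (auto simp: doubleton_eq_iff)
    assume "S \<noteq> {}"
    then obtain s where "s \<in> S" by auto
    moreover from this have "ends G s = {x, y}" using that E by auto
    ultimately show "cut_connected (ends G) {x, y} S"
      using that E unfolding cut_connected_def closed_under_def by blast
  qed
  have single: "cut_connected (ends G) {v} S \<longleftrightarrow> S = {}" if "S \<subseteq> edges G" for S v
  proof
    assume c: "cut_connected (ends G) {v} S"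
    have False if "s \<in> S" for s
    proof -
      have "ends G s \<subseteq> {v}" using c that by (simp add: cut_connected_def)
      moreover have "ends G s = {x, y}" using that \<open>S \<subseteq> edges G\<close> E by auto
      ultimately show False using V by auto
    qed
    then show "S = {}" by auto
  qed (auto simp: cut_connected_def subset_singleton_iff)
  have "(W, S) \<in> nucleus_pairs G U \<longleftrightarrow> (W, S) \<in> ?X \<union> ?Y \<union> ?Z" for W S
  proof -
    have W: "W \<subseteq> {x, y} \<longleftrightarrow> W = {} \<or> W = {x} \<or> W = {y} \<or> W = {x, y}" by blast
    have "\<not> cut_connected (ends G) {} S" by (simp add: cut_connected_def)
    then show ?thesis
      using V E U single[of S] full[of S]
      unfolding nucleus_pairs_def V(1) by (auto simp: W doubleton_eq_iff)
  qed
  then have eq: "nucleus_pairs G U = ?X \<union> ?Y \<union> ?Z"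
    by (simp only: set_eq_iff split_paired_All simp_thms)
  have "sum ?g ?Z = (\<Sum>S\<in>Pow (edges G) - {{}}. (-1) ^ card S)"
    by (subst sum.reindex) (auto simp: inj_on_def)
  also have "\<dots> = -1"
    using sum_signs_Pow[OF finE E(1)] finE by (subst sum_diff1) auto
  finally have Z: "sum ?g ?Z = -1" .
  have "sum ?g (nucleus_pairs G U) = sum ?g ?X + sum ?g ?Y + sum ?g ?Z"
    unfolding eq using V finE
    by (subst sum.union_disjoint, auto simp: doubleton_eq_iff)+
  also have "\<dots> = of_bool (U \<subseteq> {x}) + of_bool (U \<subseteq> {y}) - 1"
    unfolding Z by simp
  finally show ?thesis using V by (simp add: nucleus_sum_def)
qed

text \<open>The edge to delete and contract can be arbitrary once loops, leaves outside \<open>U\<close> and graphs on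
  two vertices have been treated: if its deletion disconnects \<open>G\<close>, the deleted graph has no nuclei
  that contain \<open>U\<close>.\<close>

lemma nucleus_sum_sign:
  assumes "fin_multigraph G" "cut_connected (ends G) (verts G) (edges G)"
    and "card (verts G) \<ge> 2" "U \<subseteq> verts G"
  shows "(U = {} \<longrightarrow> nucleus_sum G U \<ge> 0) \<and> (card U = 1 \<longrightarrow> nucleus_sum G U = 0) \<and>
         (U \<noteq> {} \<longrightarrow> nucleus_sum G U \<le> 0)"
  using assms
proof (induction "card (edges G)" arbitrary: G U rule: less_induct)
  case less
  note fin = less.prems(1) and con = less.prems(2) and V2 = less.prems(3) and U = less.prems(4)
  have finE: "finite (edges G)" and finV: "finite (verts G)"
    using fin by (auto simp: fin_multigraph_def)
  obtain v where v: "v \<in> verts G" using con by (auto simp: cut_connected_def)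
  moreover have "{v} \<noteq> verts G" using V2 by (auto dest!: arg_cong[where f = card])
  ultimately have "\<not> closed_under (ends G) (edges G) {v}"
    using cut_connectedD[OF con, of "{v}"] by auto
  then obtain e where e: "e \<in> edges G" by (auto simp: closed_under_def)
  then have endsV: "ends G e \<subseteq> verts G" and "card (ends G e) = 1 \<or> card (ends G e) = 2"
    using fin by (auto simp: fin_multigraph_def)
  consider (loop) s w where "s \<in> edges G" "ends G s = {w}"
    | (two) "card (verts G) = 2" "\<forall>s\<in>edges G. card (ends G s) = 2"
    | (leaf) s x y where "card (verts G) \<ge> 3" "leaf_at G s x y" "x \<notin> U"
    | (step) "card (verts G) \<ge> 3" "\<forall>s\<in>edges G. card (ends G s) = 2"
        "\<nexists>s x y. leaf_at G s x y \<and> x \<notin> U"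
  proof -
    have "(\<exists>s\<in>edges G. \<exists>w. ends G s = {w}) \<or> (\<forall>s\<in>edges G. card (ends G s) = 2)"
      using fin by (force simp: fin_multigraph_def card_1_singleton_iff)
    moreover have "card (verts G) = 2 \<or> card (verts G) \<ge> 3" using V2 by linarith
    ultimately show ?thesis using that by blast
  qed
  then show ?case
  proof cases
    case loop
    then show ?thesis using nucleus_sum_loop[OF fin] by auto
  next
    case leaf
    then show ?thesis using nucleus_sum_leaf[OF fin con] by auto
  next
    case two
    then obtain x y where xy: "verts G = {x, y}" "x \<noteq> y" by (auto simp: card_2_iff)
    have "\<forall>s\<in>edges G. ends G s = {x, y}"
    proof
      fix s assume s: "s \<in> edges G"
      have "ends G s \<subseteq> verts G" using fin s by (auto simp: fin_multigraph_def)
      then show "ends G s = {x, y}"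
        using card_subset_eq[of "verts G" "ends G s"] two s finV xy by simp
    qed
    then have ns: "nucleus_sum G U = of_bool (U \<subseteq> {x}) + of_bool (U \<subseteq> {y}) - 1"
      using e U xy by (intro nucleus_sum_two_verts[OF fin xy]) auto
    have "U \<subseteq> {x, y} \<longleftrightarrow> U = {} \<or> U = {x} \<or> U = {y} \<or> U = {x, y}" by blast
    then consider "U = {}" | "U = {x}" | "U = {y}" | "U = {x, y}"
      using U unfolding xy(1) by argo
    then show ?thesis using ns xy(2) by cases simp_all
  next
    case step
    obtain x y where xy: "ends G e = {x, y}" "x \<noteq> y"
      using step(2) e by (auto simp: card_2_iff)
    let ?D = "delete_edge e G" and ?C = "contract_edge e x y G" and ?r = "redirect x y"
    have fewer: "card (edges G - {e}) < card (edges G)"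
      using finE e by (rule card_Diff1_less)
    have D: "(U = {} \<longrightarrow> nucleus_sum ?D U \<ge> 0) \<and> (card U = 1 \<longrightarrow> nucleus_sum ?D U = 0) \<and>
        (U \<noteq> {} \<longrightarrow> nucleus_sum ?D U \<le> 0)"
    proof (cases "cut_connected (ends G) (verts G) (edges G - {e})")
      case True
      then show ?thesis
        using less.hyps[of ?D U] fewer fin_multigraph_delete_edge[OF fin] V2 U by simp
    next
      case False
      then have "nucleus_pairs ?D U = {}"
        using disconnecting_edge_with_nucleus_is_leaf[OF fin con e xy] step(3) by force
      then have "nucleus_sum ?D U = 0" by (simp add: nucleus_sum_def)
      then show ?thesis by linarith
    qed
    have "?r ` verts G = verts G - {x}"
      using xy endsV by (auto simp: redirect_def image_iff)
    then have "card (?r ` verts G) \<ge> 2"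
      using step(1) xy endsV finV by simp
    moreover have "cut_connected (ends ?C) (verts ?C) (edges ?C)"
      using cut_connected_contract[of "ends G" e x y "verts G" "edges G - {e}"]
        xy endsV con e by (auto simp: insert_absorb cut_connected_def)
    ultimately have C: "(?r ` U = {} \<longrightarrow> nucleus_sum ?C (?r ` U) \<ge> 0) \<and>
        (card (?r ` U) = 1 \<longrightarrow> nucleus_sum ?C (?r ` U) = 0) \<and>
        (?r ` U \<noteq> {} \<longrightarrow> nucleus_sum ?C (?r ` U) \<le> 0)"
      using less.hyps[of ?C "?r ` U"] fewer fin_multigraph_contract_edge[OF fin] U
      by (simp add: image_mono)
    have "card U = 1 \<Longrightarrow> card (?r ` U) = 1" by (auto simp: card_1_singleton_iff)
    then show ?thesis
      using C D nucleus_sum_deletion_contraction[OF fin U e xy] by auto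
  qed
qed

section \<open>The Euler characteristic as a nucleus sum\<close>

text \<open>The vertices of a nucleus are the ends of its edges, if it has any. Two different single-vertex
  nuclei force every edge to join their vertices, so that \<open>G\<close> is \<open>cK\<^sub>2\<close>; if both contain \<open>U\<close>, then
  \<open>U = {}\<close>.\<close>

lemma nucleus_verts_determined_by_edges:
  assumes fin: "fin_multigraph G" and con: "cut_connected (ends G) (verts G) (edges G)"
    and V2: "card (verts G) \<ge> 2" and not_cK2: "\<not> (is_cK2 G \<and> U = {})"
    and n: "(W, S) \<in> nucleus_pairs G U" "(W', S) \<in> nucleus_pairs G U"
  shows "W = W'"
proof (cases "S = {}")
  case False
  have "\<forall>s\<in>S. ends G s \<noteq> {}" using n fin by (force simp: nucleus_pairs_def fin_multigraph_def)
  then show ?thesis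
    using cut_connected_verts_eq_ends[of "ends G" W S] cut_connected_verts_eq_ends[of "ends G" W' S]
      n False by (auto simp: nucleus_pairs_def)
next
  case True
  then have "cut_connected (ends G) W {}" "cut_connected (ends G) W' {}"
    using n by (auto simp: nucleus_pairs_def)
  then obtain w w' where w: "W = {w}" "W' = {w'}" using cut_connected_no_edges by metis
  show ?thesis
  proof (rule ccontr)
    assume "W \<noteq> W'"
    then have ww: "w \<noteq> w'" using w by auto
    have ends_eq: "ends G s = {w, w'}" if "s \<in> edges G" for s
    proof -
      have "card (ends G s) = 1 \<or> card (ends G s) = 2" using fin that by (auto simp: fin_multigraph_def)
      moreover have "{w, w'} \<subseteq> ends G s" using n that w by (auto simp: nucleus_pairs_def)
      ultimately show ?thesis using ww by (auto simp: card_1_singleton_iff card_2_iff)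
    qed
    have wV: "w \<in> verts G" "w' \<in> verts G" using n w by (auto simp: nucleus_pairs_def)
    have "closed_under (ends G) (edges G) {w, w'}" using ends_eq by (simp add: closed_under_def)
    then have V: "{w, w'} = verts G" using wV by (intro cut_connectedD[OF con]) auto
    have "edges G \<noteq> {}"
      using con cut_connected_no_edges[of "ends G" "verts G"] V2 by auto
    moreover have "card (verts G) = 2" using ww by (simp flip: V)
    ultimately have "is_cK2 G" using fin ends_eq V by (simp add: is_cK2_def)
    moreover have "U = {}" using n w ww by (auto simp: nucleus_pairs_def)
    ultimately show False using not_cK2 by simp
  qed
qed

lemma sign_complement:
  assumes "finite E" "S \<subseteq> E"
  shows "(-1 :: int) ^ (card E + card (E - S)) = (-1) ^ card S"
proof -
  have "card E = card S + card (E - S)"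
    using assms by (metis card_Diff_subset card_mono finite_subset le_add_diff_inverse)
  then show ?thesis by (simp add: power_add mult.assoc flip: power_mult_distrib)
qed

lemma reduced_euler_char_eq_nucleus_sum:
  assumes fin: "fin_multigraph G" and con: "cut_connected (ends G) (verts G) (edges G)"
    and V2: "card (verts G) \<ge> 2" and not_cK2: "\<not> (is_cK2 G \<and> U = {})"
  shows "(-1) ^ (card (edges G) + card (verts G)) * reduced_euler_char (nucleus_complex G U) =
    - nucleus_sum G U"
proof -
  let ?E = "edges G" and ?h = "\<lambda>(W :: 'a set, S :: 'b set). (edges G - S, None :: 'a option)"
  have finE: "finite ?E" using fin by (simp add: fin_multigraph_def)
  have sub: "S \<subseteq> ?E" if "(W, S) \<in> nucleus_pairs G U" for W S
    using that by (simp add: nucleus_pairs_def)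
  have "nucleus_complex G U = ?h ` nucleus_pairs G U"
    using not_cK2 by (auto simp: nucleus_complex_def nucleus_faces_def image_image
        nucleus_pairs_conv_nuclei[OF fin])
  moreover have "inj_on ?h (nucleus_pairs G U)"
  proof (rule inj_onI; clarify)
    fix W S W' S'
    assume n: "(W, S) \<in> nucleus_pairs G U" "(W', S') \<in> nucleus_pairs G U"
      and "edges G - S = edges G - S'"
    then have "S = S'" using sub by blast
    then show "W = W' \<and> S = S'"
      using nucleus_verts_determined_by_edges[OF fin con V2 not_cK2] n by blast
  qed
  ultimately have "reduced_euler_char (nucleus_complex G U) =
      (\<Sum>(W, S)\<in>nucleus_pairs G U. (-1) ^ (card (?E - S) + 1))"
    by (simp add: reduced_euler_char_def sum.reindex case_prod_unfold)
  then have "(-1) ^ card ?E * reduced_euler_char (nucleus_complex G U) =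
      (\<Sum>(W, S)\<in>nucleus_pairs G U. - ((-1) ^ (card ?E + card (?E - S))))"
    by (simp add: sum_distrib_left case_prod_unfold power_add)
  also have "\<dots> = (\<Sum>(W, S)\<in>nucleus_pairs G U. - ((-1) ^ card S))"
    using sign_complement[OF finE] sub by (intro sum.cong) auto
  also have "\<dots> = - (\<Sum>(W, S)\<in>nucleus_pairs G U. (-1) ^ card S)"
    by (simp add: case_prod_unfold sum_negf)
  finally have "(-1) ^ card (verts G) * ((-1) ^ card ?E * reduced_euler_char (nucleus_complex G U)) =
      - nucleus_sum G U"
    by (simp add: nucleus_sum_def)
  then show ?thesis by (simp only: power_add mult.assoc mult.left_commute)
qed

text \<open>The proper faces contribute as much as one simplex on all edges with the opposite sign, so one
  of the two top simplices remains.\<close>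

lemma reduced_euler_char_cK2:
  assumes "is_cK2 G"
  shows "(-1) ^ (card (edges G) + card (verts G)) * reduced_euler_char (nucleus_complex G {}) = -1"
proof -
  let ?E = "edges G" and ?P = "{\<sigma>. \<sigma> \<subset> edges G}"
  let ?g = "\<lambda>(\<sigma> :: 'b set, l :: 'a option). (-1 :: int) ^ (card \<sigma> + 1)"
  have fin: "finite ?E" "finite (verts G)" and E: "?E \<noteq> {}" and V2: "card (verts G) = 2"
    using assms by (auto simp: is_cK2_def fin_multigraph_def)
  have P: "?P = Pow ?E - {?E}" by auto
  have "reduced_euler_char (nucleus_complex G {}) =
      sum ?g (?P \<times> {None}) + sum ?g ({?E} \<times> Some ` verts G)"
    unfolding reduced_euler_char_def nucleus_complex_def using assms fin
    by (simp, subst sum.union_disjoint) (auto simp: P)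
  also have "sum ?g (?P \<times> {None}) = - (\<Sum>\<sigma>\<in>Pow ?E - {?E}. (-1) ^ card \<sigma>)"
    unfolding P by (simp add: sum.cartesian_product[symmetric] sum_negf)
  also have "\<dots> = (-1) ^ card ?E"
    using sum_signs_Pow[OF fin(1) E] fin by (simp add: sum_diff1)
  also have "sum ?g ({?E} \<times> Some ` verts G) = - 2 * (-1) ^ card ?E"
    using V2 by (simp add: sum.cartesian_product[symmetric] card_image)
  finally show ?thesis using V2 by (simp flip: power_mult_distrib)
qed

theorem proposition6p4:
  fixes G :: "('v, 'e) multigraph" and U :: "'v set"
  assumes "fin_multigraph G"
    and "graph_connected G"
    and "card (verts G) \<ge> 2"
    and "U \<subseteq> verts G"
  shows "(U = {} \<longrightarrow>
            (- 1) ^ (card (edges G) + card (verts G)) * reduced_euler_char (nucleus_complex G U) \<le> 0) \<and>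
         (card U = 1 \<longrightarrow>
            (- 1) ^ (card (edges G) + card (verts G)) * reduced_euler_char (nucleus_complex G U) = 0) \<and>
         (card U \<ge> 1 \<longrightarrow>
            (- 1) ^ (card (edges G) + card (verts G)) * reduced_euler_char (nucleus_complex G U) \<ge> 0)"
proof (cases "is_cK2 G \<and> U = {}")
  case True
  then show ?thesis using reduced_euler_char_cK2[of G] by simp
next
  case False
  have con: "cut_connected (ends G) (verts G) (edges G)"
    using assms graph_connected_iff_cut_connected by blast
  have "card U \<ge> 1 \<Longrightarrow> U \<noteq> {}" by auto
  then show ?thesis
    using nucleus_sum_sign[OF assms(1) con assms(3,4)]
    unfolding reduced_euler_char_eq_nucleus_sum[OF assms(1) con assms(3) False] by simp
qed

end
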